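(* Let $q=3^n$ with $n$ a positive integer and let $t$ be any positive integer. Let $\alpha,\beta,\theta\in\mathbb{F}_q^*$ and define $f:\mathbb{F}_q\to\mathbb{F}_q$ by $f(0)=0$, $f(x)=\beta(x^3+\theta x^2+\theta^2x)$ if $x\in C_0$, and $f(x)=\alpha x^t$ if $x\in C_1$. Then $f$ is a permutation polynomial of $\mathbb{F}_q$ if and only if $\gcd\left(t,\frac{q-1}{2}\right)=1$, $\eta(\theta)=-1$, and one of the following holds: (i) $t$ is odd and $\eta(\alpha)=\eta(\beta)$; (ii) $t$ is even and $\eta(\alpha)=-\eta(\beta)$. In this case, $f$ is given on $\mathbb{F}_q$ by $$f(x)=-(\beta x^3+\beta\theta x^2+\beta\theta^2x-\alpha x^t)x^{\frac{3^n-1}{2}}-(\beta x^3+\beta\theta x^2+\beta\theta^2x+\alpha x^t).$$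
   Context: $C_0$ is the set of nonzero squares of $\mathbb{F}_q$ and $C_1$ the set of non-squares. $\eta$ is the quadratic character of $\mathbb{F}_q$ ($1$ on nonzero squares, $-1$ on non-squares). A map (or polynomial) is a permutation polynomial (PP) of $\mathbb{F}_q$ if it induces a bijection of $\mathbb{F}_q$. *)

theory Defs
  imports Main "HOL-Library.Cardinality"
begin

text \<open>The field with \<open>q\<close> elements is a type of class \<open>{field, finite}\<close> with \<open>CARD('a) = q\<close>.\<close>

definition C0 :: "'a::field set" where
  "C0 = {x. x \<noteq> 0 \<and> (\<exists>y. x = y ^ 2)}"

text \<open>Note that \<open>0 = 0 ^ 2\<close> is a square, hence belongs to neither \<open>C0\<close> nor \<open>C1\<close>.\<close>

definition C1 :: "'a::field set" where
  "C1 = {x. \<not> (\<exists>y. x = y ^ 2)}"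

text \<open>Quadratic character, with the usual convention \<open>\<eta>(0) = 0\<close>.\<close>

definition quad_char :: "'a::field \<Rightarrow> int" where
  "quad_char x = (if x \<in> C0 then 1 else if x \<in> C1 then -1 else 0)"

text \<open>On a finite field every map is given by a polynomial, so the notion is defined for maps.\<close>

definition permutation_polynomial :: "('a::{field,finite} \<Rightarrow> 'a) \<Rightarrow> bool" where
  "permutation_polynomial f \<longleftrightarrow> bij f"

end

theory Submission
  imports Defs "HOL-Computational_Algebra.Polynomial"
begin

text \<open>
  In characteristic 3 we have \<open>x\<^sup>3 + \<theta> x\<^sup>2 + \<theta>\<^sup>2 x = x (x - \<theta>)\<^sup>2\<close>. If \<open>\<theta>\<close> is a square, then \<open>f\<close> has the
  two zeros \<open>0\<close> and \<open>\<theta>\<close>. If \<open>\<theta>\<close> is not a square, this cubic maps \<open>C0\<close> into itself, and injectively: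
  equal values at \<open>a\<^sup>2 \<noteq> b\<^sup>2\<close> would give \<open>(\<theta> - (a + b)\<^sup>2) (\<theta> - (a - b)\<^sup>2) = 0\<close>. The condition on the
  gcd is injectivity of \<open>x \<mapsto> x\<^sup>t\<close> on \<open>C1\<close>, and the condition on \<open>\<alpha>\<close> and \<open>\<beta>\<close> says that \<open>C0\<close> and \<open>C1\<close>
  are mapped to different classes.
\<close>

section \<open>Squares in a finite field of odd order\<close>

text \<open>Translation by 1 permutes the field, so adding 1 to every summand leaves the sum of all
  elements unchanged.\<close>

lemma of_nat_card_eq_0: "of_nat CARD('a) = (0::'a::{field,finite})"
proof -
  have "(\<Sum>x\<in>(UNIV::'a set). x) = (\<Sum>x\<in>(UNIV::'a set). x + 1)"
    by (rule sum.reindex_bij_witness[where i = "\<lambda>x. x + 1" and j = "\<lambda>x. x - 1"]) auto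
  then show ?thesis
    by (simp add: sum.distrib)
qed

text \<open>Multiplication by \<open>x\<close> permutes the nonzero elements; their product is
  nonzero and can be cancelled.\<close>

lemma power_card_minus_1:
  fixes x :: "'a::{field,finite}"
  assumes "x \<noteq> 0"
  shows "x ^ (CARD('a) - 1) = 1"
proof -
  have "(\<Prod>y\<in>UNIV - {0}. y) = (\<Prod>y\<in>UNIV - {0}. x * y)"
    by (rule prod.reindex_bij_witness[where i = "\<lambda>y. x * y" and j = "\<lambda>y. y / x"]) (use assms in auto)
  also have "\<dots> = x ^ (CARD('a) - 1) * (\<Prod>y\<in>UNIV - {0}. y)"
    by (simp add: prod.distrib card_Diff_singleton)
  finally show ?thesis
    by simp
qed

lemma card_power_eq_1_le:
  assumes "k > 0"
  shows "card {x::'a::{field,finite}. x ^ k = 1} \<le> k"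
proof -
  let ?p = "monom 1 k - 1 :: 'a poly"
  have "coeff ?p k = 1"
    using assms by simp
  then have "?p \<noteq> 0"
    by (metis coeff_0 zero_neq_one)
  then have "card {x. poly ?p x = 0} \<le> degree ?p"
    by (rule card_poly_roots_bound)
  also have "\<dots> \<le> k"
    by (intro degree_diff_le) (auto simp: degree_monom_eq)
  finally show ?thesis
    by (simp add: poly_monom)
qed

text \<open>Root counting takes the place of a primitive root: this yields a non-square and, further
  on, a nontrivial root of unity.\<close>

lemma exists_power_neq_1:
  assumes "0 < k" "k < CARD('a) - 1"
  shows "\<exists>x::'a::{field,finite}. x \<noteq> 0 \<and> x ^ k \<noteq> 1"
proof (rule ccontr)
  assume "\<not> ?thesis"
  then have "UNIV - {0} \<subseteq> {x::'a. x ^ k = 1}"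
    by auto
  then have "card (UNIV - {0::'a}) \<le> card {x::'a. x ^ k = 1}"
    by (intro card_mono) auto
  also have "\<dots> \<le> k"
    by (rule card_power_eq_1_le) fact
  finally show False
    using assms by (simp add: card_Diff_singleton)
qed

text \<open>If 2 vanished, an odd cardinality would be 1 in the field, whereas it is 0
  there.\<close>

lemma minus_1_neq_1:
  assumes "odd CARD('a)"
  shows "(-1::'a::{field,finite}) \<noteq> 1"
proof
  assume "(-1::'a) = 1"
  then have 2: "(2::'a) = 0"
    by (metis add.right_inverse one_add_one)
  from assms obtain k where "CARD('a) = 2 * k + 1"
    by (rule oddE)
  then have "of_nat CARD('a) = (1::'a)"
    using 2 by simp
  then show False
    by (simp add: of_nat_card_eq_0)
qed

lemma card_half_bound:
  assumes "odd CARD('a::{field,finite})"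
  shows "2 * ((CARD('a) - 1) div 2) = CARD('a) - 1" and "(CARD('a) - 1) div 2 > 0"
proof -
  show "2 * ((CARD('a) - 1) div 2) = CARD('a) - 1"
    using assms by simp
  have "card {0, 1::'a} \<le> CARD('a)"
    by (rule card_mono) auto
  then show "(CARD('a) - 1) div 2 > 0"
    using assms by (auto elim!: oddE)
qed

section \<open>Euler's criterion\<close>

lemma power_half_cases:
  fixes x :: "'a::{field,finite}"
  assumes "odd CARD('a)" "x \<noteq> 0"
  shows "x ^ ((CARD('a) - 1) div 2) = 1 \<or> x ^ ((CARD('a) - 1) div 2) = -1"
proof -
  have "(x ^ ((CARD('a) - 1) div 2))\<^sup>2 = x ^ (CARD('a) - 1)"
    using card_half_bound(1)[where 'a = 'a, OF assms(1)] by (metis power_even_eq)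
  also have "\<dots> = 1"
    by (rule power_card_minus_1[OF assms(2)])
  finally show ?thesis
    by (simp add: power2_eq_1_iff)
qed

lemma zero_notin_C0 [simp]: "0 \<notin> C0" and zero_notin_C1 [simp]: "0 \<notin> C1"
  by (simp add: C0_def) (metis (mono_tags, lifting) C1_def mem_Collect_eq zero_power2)

text \<open>Nonzero squares are roots of X^m - 1 with m = (q - 1)/2, which has at most m roots.
  Squaring is at most two-to-one, so there are at least m nonzero squares, and the two sets
  agree.\<close>

theorem euler_criterion:
  assumes "odd CARD('a::{field,finite})"
  shows "C0 = {x::'a. x ^ ((CARD('a) - 1) div 2) = 1}"
proof (rule card_seteq)
  let ?m = "(CARD('a) - 1) div 2"
  show "finite {x::'a. x ^ ?m = 1}"
    by simp
  show "C0 \<subseteq> {x::'a. x ^ ?m = 1}"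
  proof safe
    fix x :: 'a assume "x \<in> C0"
    then obtain y where y: "y \<noteq> 0" "x = y ^ 2"
      by (auto simp: C0_def)
    have "x ^ ?m = y ^ (2 * ?m)"
      by (simp add: y power_mult)
    also have "\<dots> = 1"
      by (simp only: card_half_bound(1)[OF assms] power_card_minus_1[OF y(1)])
    finally show "x ^ ?m = 1" .
  qed
  have "(UNIV - {0::'a}) \<subseteq> (\<Union>x\<in>C0. {y. y ^ 2 = x})"
    by (auto simp: C0_def)
  then have "card (UNIV - {0::'a}) \<le> card (\<Union>x\<in>C0. {y::'a. y ^ 2 = x})"
    by (intro card_mono) auto
  also have "\<dots> \<le> (\<Sum>x\<in>C0. card {y::'a. y ^ 2 = x})"
    by (intro card_UN_le) auto
  also have "\<dots> \<le> (\<Sum>x\<in>(C0::'a set). 2)"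
  proof (rule sum_mono)
    fix x :: 'a assume "x \<in> C0"
    then obtain y where "x = y ^ 2"
      by (auto simp: C0_def)
    then have "{y. y ^ 2 = x} = {y, -y}"
      by (auto simp: power2_eq_iff)
    then show "card {y. y ^ 2 = x} \<le> 2"
      by (simp add: card_insert_le_m1)
  qed
  finally have "?m \<le> card (C0::'a set)"
    by (simp add: card_Diff_singleton)
  moreover have "card {x::'a. x ^ ?m = 1} \<le> ?m"
    by (rule card_power_eq_1_le) (rule card_half_bound(2)[OF assms])
  ultimately show "card {x::'a. x ^ ?m = 1} \<le> card (C0::'a set)"
    by simp
qed

lemma C1_iff_power_half:
  assumes "odd CARD('a::{field,finite})"
  shows "(x::'a) \<in> C1 \<longleftrightarrow> x ^ ((CARD('a) - 1) div 2) = -1"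
proof -
  let ?m = "(CARD('a) - 1) div 2"
  have "x \<in> C1 \<longleftrightarrow> x \<noteq> 0 \<and> x \<notin> C0"
    by (cases "x = 0") (auto simp: C0_def C1_def)
  also have "\<dots> \<longleftrightarrow> x ^ ?m = -1"
    using power_half_cases[OF assms, of x] minus_1_neq_1[where 'a = 'a, OF assms]
      card_half_bound(2)[where 'a = 'a, OF assms]
    by (auto simp: euler_criterion[OF assms] power_0_left)
  finally show ?thesis .
qed

section \<open>Multiplicativity of the quadratic character\<close>

lemma quad_char_simps:
  "x \<in> C0 \<Longrightarrow> quad_char x = 1" "x \<in> C1 \<Longrightarrow> quad_char x = -1"
  by (auto simp: quad_char_def C0_def C1_def)

lemma power_half_eq_quad_char:
  fixes x :: "'a::{field,finite}"
  assumes "odd CARD('a)"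
  shows "x ^ ((CARD('a) - 1) div 2) = of_int (quad_char x)"
proof (cases "x = 0")
  case True
  then show ?thesis
    using card_half_bound(2)[where 'a = 'a, OF assms]
    by (simp add: quad_char_def)
next
  case False
  then show ?thesis
    using power_half_cases[OF assms False]
    by (auto simp: quad_char_simps C1_iff_power_half[OF assms] euler_criterion[OF assms])
qed

lemma quad_char_cases:
  "x \<noteq> 0 \<Longrightarrow> x \<in> C0 \<and> quad_char x = 1 \<or> x \<in> C1 \<and> quad_char x = -1"
  by (auto simp: quad_char_def C0_def C1_def)

text \<open>By Euler's criterion the identity holds in the field. It lifts to the integers because
  -1, 0 and 1 stay distinct in odd characteristic.\<close>

lemma quad_char_mult:
  fixes x y :: "'a::{field,finite}"
  assumes "odd CARD('a)"
  shows "quad_char (x * y) = quad_char x * quad_char y"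
proof -
  have eq: "of_int (quad_char (x * y)) = (of_int (quad_char x) * of_int (quad_char y) :: 'a)"
    by (simp only: power_mult_distrib flip: power_half_eq_quad_char[OF assms])
  have range: "quad_char z = -1 \<or> quad_char z = 0 \<or> quad_char z = 1" for z :: 'a
    by (simp add: quad_char_def)
  show ?thesis
    using eq minus_1_neq_1[where 'a = 'a, OF assms] minus_1_neq_1[where 'a = 'a, OF assms, symmetric]
      range[of x] range[of y] range[of "x * y"]
    by (elim disjE) simp_all
qed

lemma quad_char_power:
  fixes x :: "'a::{field,finite}"
  assumes "odd CARD('a)"
  shows "quad_char (x ^ k) = quad_char x ^ k"
proof (induction k)
  case 0
  have "(1::'a) \<in> C0"
    by (auto simp: C0_def intro: exI[of _ 1])
  then show ?case
    by (simp add: quad_char_simps)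
qed (simp add: quad_char_mult[OF assms])

section \<open>Power maps on the non-squares\<close>

lemma exists_C1:
  assumes "odd CARD('a::{field,finite})"
  shows "\<exists>x::'a. x \<in> C1"
proof -
  let ?m = "(CARD('a) - 1) div 2"
  have "0 < ?m" "?m < CARD('a) - 1"
    using card_half_bound[OF assms] by linarith+
  then obtain x :: 'a where "x \<noteq> 0" "x ^ ?m \<noteq> 1"
    using exists_power_neq_1 by blast
  then show ?thesis
    using power_half_cases[OF assms] by (auto simp: C1_iff_power_half[OF assms])
qed

text \<open>Quotients of non-squares are the m-th roots of unity, m = (q - 1)/2. Injectivity thus
  says that \<open>u ^ t = 1\<close> and \<open>u ^ m = 1\<close> only for \<open>u = 1\<close>,
  that is, that \<open>t\<close> and m are coprime.\<close>

lemma inj_on_power_C1_iff: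
  assumes "odd CARD('a::{field,finite})"
  shows "inj_on (\<lambda>x::'a. x ^ t) C1 \<longleftrightarrow> gcd t ((CARD('a) - 1) div 2) = 1"
proof
  let ?m = "(CARD('a) - 1) div 2"
  note m = card_half_bound[where 'a = 'a, OF assms]
  assume inj: "inj_on (\<lambda>x::'a. x ^ t) C1"
  show "gcd t ?m = 1"
  proof (rule ccontr)
    define d where "d = gcd t ?m"
    assume "gcd t ?m \<noteq> 1"
    then have "d > 1"
      using m(2) unfolding d_def
      by (metis gcd_pos_nat less_numeral_extra(3) less_one linorder_neqE_nat)
    obtain k where k: "?m = d * k"
      unfolding d_def by (metis dvdE gcd_dvd2)
    obtain s where s: "t = d * s"
      unfolding d_def by (metis dvdE gcd_dvd1)
    have "k > 0"
      using m(2) k by simp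
    \<comment> \<open>The exponent \<open>2 * k\<close> is (q - 1)/d, below q - 1 as
      \<open>d > 1\<close>, so some power \<open>u = y ^ (2 * k)\<close> differs from 1. It is a
      nonzero square with \<open>u ^ d = 1\<close>, and \<open>d\<close> divides
      \<open>t\<close>.\<close>
    then have "2 * k < 2 * (d * k)"
      using \<open>d > 1\<close> by simp
    then have "0 < 2 * k" "2 * k < CARD('a) - 1"
      using m(1) \<open>k > 0\<close> unfolding k by linarith+
    then obtain y :: 'a where y: "y \<noteq> 0" "y ^ (2 * k) \<noteq> 1"
      using exists_power_neq_1 by blast
    define u where "u = y ^ (2 * k)"
    have "u ^ d = y ^ (2 * ?m)"
      by (simp only: u_def k power_mult[symmetric] mult_ac)
    also have "\<dots> = 1"
      by (simp only: m(1) power_card_minus_1[OF y(1)])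
    finally have "u ^ t = 1"
      by (simp add: s power_mult)
    have "u \<in> C0"
      using y by (auto simp: u_def C0_def power_even_eq)
    \<comment> \<open>Scaling a non-square by \<open>u\<close> gives another non-square with the
      same \<open>t\<close>-th power.\<close>
    obtain c :: 'a where "c \<in> C1"
      using exists_C1[OF assms] by blast
    moreover have "c * u \<in> C1"
      using \<open>c \<in> C1\<close> \<open>u \<in> C0\<close>
      by (simp add: C1_iff_power_half[OF assms] euler_criterion[OF assms] power_mult_distrib)
    moreover have "(c * u) ^ t = c ^ t"
      using \<open>u ^ t = 1\<close> by (simp add: power_mult_distrib)
    ultimately have "c * u = c"
      using inj by (auto dest: inj_onD)
    moreover have "c \<noteq> 0"
      using \<open>c \<in> C1\<close> by auto
    ultimately show False
      using y by (simp add: u_def)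
  qed
next
  let ?m = "(CARD('a) - 1) div 2"
  assume gcd: "gcd t ?m = 1"
  show "inj_on (\<lambda>x::'a. x ^ t) C1"
  proof (rule inj_onI)
    fix x y :: 'a
    assume xy: "x \<in> C1" "y \<in> C1" "x ^ t = y ^ t"
    then have "y \<noteq> 0"
      by auto
    define u where "u = x / y"
    have "u ^ t = 1" "u ^ ?m = 1"
      using xy \<open>y \<noteq> 0\<close> by (auto simp: u_def power_divide C1_iff_power_half[OF assms])
    have "u = 1"
    \<comment> \<open>Bezout's identity in this form needs \<open>t\<close> nonzero; for
      \<open>t = 0\<close> the gcd is m itself, so m = 1.\<close>
    proof (cases "t = 0")
      case True
      then show ?thesis
        using gcd \<open>u ^ ?m = 1\<close> by simp
    next
      case False
      then obtain a b where ab: "t * a = ?m * b + 1"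
        using bezout_nat[of t ?m] gcd by auto
      have "u = u ^ (?m * b + 1)"
        using \<open>u ^ ?m = 1\<close> by (simp add: power_mult)
      also have "\<dots> = 1"
        using \<open>u ^ t = 1\<close> by (simp only: power_mult power_one flip: ab)
      finally show ?thesis .
    qed
    then show "x = y"
      using \<open>y \<noteq> 0\<close> by (simp add: u_def)
  qed
qed

section \<open>The cubic in characteristic 3\<close>

lemma char3_cubic:
  fixes x \<theta> :: "'a::field"
  assumes "(3::'a) = 0"
  shows "x ^ 3 + \<theta> * x ^ 2 + \<theta> ^ 2 * x = x * (x - \<theta>) ^ 2"
proof -
  have "x ^ 3 + \<theta> * x ^ 2 + \<theta> ^ 2 * x = x * (x - \<theta>) ^ 2 + 3 * (\<theta> * x ^ 2)"
    by algebra
  then show ?thesis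
    by (simp add: assms)
qed

lemma inj_on_cubic_C0:
  fixes \<theta> :: "'a::field"
  assumes "(3::'a) = 0" "\<theta> \<in> C1"
  shows "inj_on (\<lambda>x. x * (x - \<theta>) ^ 2) C0"
proof (rule inj_onI, rule ccontr)
  fix x y :: 'a
  assume "x \<in> C0" "y \<in> C0" and eq: "x * (x - \<theta>) ^ 2 = y * (y - \<theta>) ^ 2" and "x \<noteq> y"
  then obtain a b where ab: "x = a ^ 2" "y = b ^ 2"
    by (auto simp: C0_def)
  \<comment> \<open>Up to a multiple of 3, the difference quotient of the cubic is a quadratic in
    \<theta> with roots \<open>(a + b) ^ 2\<close> and \<open>(a - b) ^ 2\<close>.\<close>
  have "(x - y) * ((\<theta> - (a + b) ^ 2) * (\<theta> - (a - b) ^ 2)) =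
      x * (x - \<theta>) ^ 2 - y * (y - \<theta>) ^ 2 - 3 * (x - y) * x * y"
    unfolding ab by algebra
  then have "(\<theta> - (a + b) ^ 2) * (\<theta> - (a - b) ^ 2) = 0"
    using eq assms(1) \<open>x \<noteq> y\<close> by simp
  then show False
    using assms(2) by (auto simp: C1_def)
qed

section \<open>The permutation criterion\<close>

theorem theorem2p13:
  fixes n t :: nat
    and \<alpha> \<beta> \<theta> :: "'a::{field,finite}"
    and f :: "'a \<Rightarrow> 'a"
  assumes "n > 0"
    and "CARD('a) = 3 ^ n"
    and "t > 0"
    and "\<alpha> \<noteq> 0" and "\<beta> \<noteq> 0" and "\<theta> \<noteq> 0"
    and "f 0 = 0"
    and "\<And>x. x \<in> C0 \<Longrightarrow> f x = \<beta> * (x ^ 3 + \<theta> * x ^ 2 + \<theta> ^ 2 * x)"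
    and "\<And>x. x \<in> C1 \<Longrightarrow> f x = \<alpha> * x ^ t"
  shows "(permutation_polynomial f \<longleftrightarrow>
           gcd t ((3 ^ n - 1) div 2) = 1 \<and>
           quad_char \<theta> = -1 \<and>
           ((odd t \<and> quad_char \<alpha> = quad_char \<beta>) \<or>
            (even t \<and> quad_char \<alpha> = - quad_char \<beta>)))
       \<and> (permutation_polynomial f \<longrightarrow>
           (\<forall>x. f x =
              - (\<beta> * x ^ 3 + \<beta> * \<theta> * x ^ 2 + \<beta> * \<theta> ^ 2 * x - \<alpha> * x ^ t) * x ^ ((3 ^ n - 1) div 2)
              - (\<beta> * x ^ 3 + \<beta> * \<theta> * x ^ 2 + \<beta> * \<theta> ^ 2 * x + \<alpha> * x ^ t)))"
proof -
  have odd: "odd CARD('a)"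
    by (simp add: assms(2))
  have "(3::'a) ^ n = 0"
    using of_nat_card_eq_0[where 'a = 'a] by (simp add: assms(2))
  then have 3: "(3::'a) = 0"
    by simp
  have f0: "f x = \<beta> * (x * (x - \<theta>) ^ 2)" if "x \<in> C0" for x
    using assms(8)[OF that] by (simp add: char3_cubic[OF 3])
  note f1 = assms(9)
  have cases: "x = 0 \<or> x \<in> C0 \<or> x \<in> C1" for x :: 'a
    by (auto simp: C0_def C1_def)
  have neq0: "x \<noteq> 0" if "x \<in> C0 \<or> x \<in> C1" for x :: 'a
    using that by auto
  let ?sgn = "(odd t \<and> quad_char \<alpha> = quad_char \<beta>) \<or> (even t \<and> quad_char \<alpha> = - quad_char \<beta>)"
  have char_f0: "quad_char (f x) = quad_char \<beta>" if "x \<in> C0" "\<theta> \<in> C1" for x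
  proof -
    \<comment> \<open>The factor \<open>(x - \<theta>) ^ 2\<close> is then a nonzero square, so only
      \<beta> contributes to the character.\<close>
    have "x \<noteq> \<theta>"
      using that by (auto simp: C0_def C1_def)
    then have "(x - \<theta>) ^ 2 \<in> C0"
      by (auto simp: C0_def)
    then show ?thesis
      using that by (simp add: f0 quad_char_mult[OF odd] quad_char_simps)
  qed
  have char_f1: "quad_char (f x) = quad_char \<alpha> * (-1) ^ t" if "x \<in> C1" for x
    using that by (simp add: f1 quad_char_mult[OF odd] quad_char_power[OF odd] quad_char_simps)
  \<comment> \<open>Both characters are 1 or -1, so the two parity cases merge into one condition:
    the images of \<open>C0\<close> and \<open>C1\<close> have different characters.\<close>
  have sgn_iff: "?sgn \<longleftrightarrow> quad_char \<alpha> * (-1) ^ t \<noteq> quad_char \<beta>"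
    using quad_char_cases[OF assms(4)] quad_char_cases[OF assms(5)] by (cases "odd t") auto
  have perm: "bij f \<longleftrightarrow> gcd t ((3 ^ n - 1) div 2) = 1 \<and> quad_char \<theta> = -1 \<and> ?sgn"
  proof (intro iffI conjI)
    assume "bij f"
    then have inj: "inj f" and surj: "surj f"
      by (auto simp: bij_def)
    \<comment> \<open>Otherwise the cubic would vanish at \<theta>, giving
      \<open>f \<theta> = f 0\<close>.\<close>
    have "\<theta> \<notin> C0"
      using f0[of \<theta>] assms(6,7) injD[OF inj, of \<theta> 0] by auto
    then have \<theta>: "\<theta> \<in> C1"
      using cases assms(6) by blast
    then show "quad_char \<theta> = -1"
      by (rule quad_char_simps)
    have "inj_on (\<lambda>x. x ^ t) (C1 :: 'a set)"
      using inj_on_subset[OF inj, of C1] by (auto simp: inj_on_def f1)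
    then show "gcd t ((3 ^ n - 1) div 2) = 1"
      by (simp add: inj_on_power_C1_iff[OF odd] assms(2))
    show ?sgn
    proof (rule ccontr)
      assume "\<not> ?sgn"
      then have *: "quad_char (f x) = quad_char \<beta>" if "x \<noteq> 0" for x
        using cases[of x] that char_f0[OF _ \<theta>] char_f1 sgn_iff by auto
      \<comment> \<open>All nonzero arguments now have values of the same character as \<beta>, so
        \<open>\<beta> * c\<close> with \<open>c\<close> a non-square would be missed, against
        surjectivity.\<close>
      obtain c :: 'a where c: "c \<in> C1"
        using exists_C1[OF odd] by blast
      obtain x where x: "f x = \<beta> * c"
        using surj by (metis surjD)
      then have "x \<noteq> 0"
        using assms(5,7) c neq0 by auto
      then have "quad_char \<beta> = - quad_char \<beta>"
        using *[of x] c by (simp add: x quad_char_mult[OF odd] quad_char_simps)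
      then show False
        using quad_char_cases[OF assms(5)] by auto
    qed
  next
    assume rhs: "gcd t ((3 ^ n - 1) div 2) = 1 \<and> quad_char \<theta> = -1 \<and> ?sgn"
    have \<theta>: "\<theta> \<in> C1"
      using quad_char_cases[OF assms(6)] rhs by auto
    have "inj_on (\<lambda>x. x ^ t) (C1 :: 'a set)"
      using rhs by (simp add: inj_on_power_C1_iff[OF odd] assms(2))
    then have inj1: "inj_on f C1"
      using assms(4) by (auto simp: inj_on_def f1)
    have inj0: "inj_on f C0"
      using inj_on_cubic_C0[OF 3 \<theta>] assms(5) by (auto simp: inj_on_def f0)
    \<comment> \<open>The only nonzero root of the cubic is \<theta>, which lies outside the class
      where the cubic defines \<open>f\<close>.\<close>
    have "\<theta> \<notin> C0"
      using \<theta> by (auto simp: C0_def C1_def)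
    then have nz: "f x \<noteq> 0" if "x \<noteq> 0" for x
      using cases[of x] that assms(4,5) by (auto simp: f0 f1)
    have sep: "f x \<noteq> f y" if "x \<in> C0" "y \<in> C1" for x y
      using char_f0[OF that(1) \<theta>] char_f1[OF that(2)] rhs sgn_iff by auto
    have "x = y" if "f x = f y" for x y
    proof (cases "x = 0 \<or> y = 0")
      case True
      then show ?thesis
        using nz that assms(7) by metis
    next
      case False
      then show ?thesis
        using cases[of x] cases[of y] sep that inj_onD[OF inj0 that] inj_onD[OF inj1 that] by metis
    qed
    then have "inj f"
      by (rule injI)
    then show "bij f"
      by (simp add: bij_def finite_UNIV_inj_surj)
  qed
  have formula: "f x = - (\<beta> * x ^ 3 + \<beta> * \<theta> * x ^ 2 + \<beta> * \<theta> ^ 2 * x - \<alpha> * x ^ t) * x ^ ((3 ^ n - 1) div 2)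
              - (\<beta> * x ^ 3 + \<beta> * \<theta> * x ^ 2 + \<beta> * \<theta> ^ 2 * x + \<alpha> * x ^ t)" for x
  proof -
    \<comment> \<open>The half power is 1 on \<open>C0\<close> and -1 on \<open>C1\<close>. In
      either case the other branch cancels from the right-hand side and \<open>- 2 * f x\<close>
      remains, which is \<open>f x\<close> in characteristic 3.\<close>
    have eq: "y = - 2 * y" for y :: 'a
    proof -
      have "y = - 2 * y + 3 * y"
        by algebra
      then show ?thesis
        by (simp only: 3 mult_zero_left add_0_right)
    qed
    consider "x = 0" | "x \<in> C0" | "x \<in> C1"
      using cases by blast
    then show ?thesis
    proof cases
      case 1
      then show ?thesis
        using assms(3,7) by simp
    next
      case 2
      then have "x ^ ((3 ^ n - 1) div 2) = 1"
        using euler_criterion[OF odd] assms(2) by auto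
      then show ?thesis
        using eq[of "f x"] unfolding assms(8)[OF 2] by (simp add: algebra_simps)
    next
      case 3
      then have "x ^ ((3 ^ n - 1) div 2) = -1"
        using C1_iff_power_half[OF odd] assms(2) by auto
      then show ?thesis
        using eq[of "f x"] unfolding f1[OF 3] by (simp add: algebra_simps)
    qed
  qed
  show ?thesis
    using perm formula by (auto simp: permutation_polynomial_def)
qed

end
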